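(* Let $n=p^{e}$ where $p>3$ is a prime and $e>1$ is an integer. Then in $\mathbb{Z}_{n}[X]$ there are exactly $n\,\phi(n)$ linear permutation polynomials, exactly $[n-\phi(n)-1]\,n\,\phi(n)$ quadratic permutation polynomials, and exactly $[n-\phi(n)-1]\,[n-\phi(n)]\,n\,\phi(n)$ cubic permutation polynomials.
   Context: $\mathbb{Z}_n$ is the ring of integers modulo $n$ and $\phi$ is Euler's totient function. A polynomial $f(X)\in\mathbb{Z}_n[X]$ is a permutation polynomial if the induced map $f:\mathbb{Z}_n\to\mathbb{Z}_n$ is a bijection. Linear, quadratic and cubic polynomials are formal polynomials in $\mathbb{Z}_n[X]$ of degree exactly $1$, $2$, $3$ respectively (leading coefficient nonzero, not necessarily a unit), and polynomials are counted as elements of $\mathbb{Z}_n[X]$, i.e. by their coefficients (including the constant term), not as functions. *)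

theory Defs
  imports
    "HOL-Number_Theory.Residues"
    "HOL-Number_Theory.Totient"
    "HOL-Algebra.Polynomials"
begin

(* univ_poly R (carrier R) consists of the normalized coefficient lists over R (the head is the
   leading coefficient and is nonzero), so its elements are formal polynomials. *)
definition permutation_polynomial :: "('a, 'b) ring_scheme \<Rightarrow> 'a list \<Rightarrow> bool" where
  "permutation_polynomial R f \<longleftrightarrow>
     f \<in> carrier (univ_poly R (carrier R)) \<and> bij_betw (ring.eval R f) (carrier R) (carrier R)"

(* The degree abbreviation is length f - 1 on nat, so it is 0 both for constants and for the
   zero polynomial []; for d \<ge> 1 the condition is "degree exactly d". *)
definition permutation_polynomials_of_degree ::
    "('a, 'b) ring_scheme \<Rightarrow> nat \<Rightarrow> 'a list set" where
  "permutation_polynomials_of_degree R d =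
     {f. permutation_polynomial R f \<and> Polynomials.degree f = d}"

end

theory Submission
  imports Defs
begin

text \<open>
  For \<open>f = aX^3 + bX^2 + cX + d\<close> we have \<open>f(x) - f(y) = (x - y) q(x, y)\<close> with
  \<open>q = a(x^2 + xy + y^2) + b(x + y) + c\<close>.  Over the residues modulo \<open>p^e\<close>, \<open>e > 1\<close>, the map \<open>f\<close>
  is bijective iff \<open>q\<close> has no zero modulo \<open>p\<close>: a zero with \<open>x \<noteq> y\<close> contradicts injectivity modulo
  \<open>p\<close>, and a zero with \<open>x = y\<close> gives \<open>f(x + p^(e-1)) = f(x)\<close>.  If \<open>p\<close> does not divide \<open>a\<close>, then
  \<open>q = 0\<close> is, up to an affine change of variables, \<open>w^2 + 3a^2v^2 = 4b^2 - 12ac\<close>, which is solvable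
  by the pigeonhole principle as \<open>p > 3\<close>.  If \<open>p\<close> divides \<open>a\<close> but not \<open>b\<close>, then \<open>q\<close> is a nonconstant
  affine function.  So \<open>f\<close> permutes the residues iff \<open>p\<close> divides \<open>a\<close> and \<open>b\<close> but not \<open>c\<close>.
\<close>

section \<open>Values of w^2 + A v^2 modulo an odd prime\<close>

lemma binary_quadratic_form_universal_mod_prime:
  fixes p A k :: int
  assumes p: "Factorial_Ring.prime p" and "p > 2" and A: "\<not> p dvd A"
  shows "\<exists>w v. [w\<^sup>2 + A * v\<^sup>2 = k] (mod p)"
proof (rule ccontr)
  assume no: "\<not> ?thesis"
  \<comment> \<open>One representative of each pair x, -x modulo the odd prime \<open>p\<close>, so
    squares of distinct elements stay distinct modulo \<open>p\<close>.\<close>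
  define H where "H = {0..(p - 1) div 2}"
  have odd: "odd p"
    using p \<open>p > 2\<close> prime_odd_int by auto
  have sq: "x = y" if "x \<in> H" "y \<in> H" "p dvd x\<^sup>2 - y\<^sup>2" for x y
  proof -
    have "p dvd (x - y) * (x + y)"
      using that(3) by (simp add: power2_eq_square algebra_simps)
    then consider "p dvd x - y" | "p dvd x + y"
      using p prime_dvd_mult_iff by blast
    then show ?thesis
    proof cases
      case 1
      have "\<bar>x - y\<bar> < p" using that(1,2) \<open>p > 2\<close> by (auto simp: H_def)
      with 1 show ?thesis
        by (metis dvd_imp_le_int abs_of_pos eq_iff_diff_eq_0 not_le \<open>p > 2\<close> order.strict_trans zero_less_numeral)
    next
      case 2
      have "x + y < p" "x \<ge> 0" "y \<ge> 0" using that(1,2) \<open>p > 2\<close> by (auto simp: H_def)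
      with 2 have "x + y = 0" using zdvd_imp_le by fastforce
      with \<open>x \<ge> 0\<close> \<open>y \<ge> 0\<close> show ?thesis by linarith
    qed
  qed
  \<comment> \<open>If \<open>k\<close> were not represented, the sets \<open>B\<close> and
    \<open>C\<close> would be disjoint. Each has (p + 1)/2 elements, so together they would have p +
    1, too many for \<open>p\<close> residues.\<close>
  define B C where "B = (\<lambda>w. w\<^sup>2 mod p) ` H" and "C = (\<lambda>v. (k - A * v\<^sup>2) mod p) ` H"
  have "inj_on (\<lambda>w. w\<^sup>2 mod p) H"
    by (intro inj_onI sq) (auto simp: mod_eq_dvd_iff)
  then have cB: "card B = card H" unfolding B_def by (rule card_image)
  have "inj_on (\<lambda>v. (k - A * v\<^sup>2) mod p) H"
  proof (intro inj_onI sq)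
    fix x y assume "(k - A * x\<^sup>2) mod p = (k - A * y\<^sup>2) mod p"
    then have "p dvd (k - A * y\<^sup>2) - (k - A * x\<^sup>2)"
      by (metis mod_eq_dvd_iff)
    then have "p dvd A * (x\<^sup>2 - y\<^sup>2)" by (simp add: algebra_simps)
    with A p show "p dvd x\<^sup>2 - y\<^sup>2" using prime_dvd_mult_iff by blast
  qed
  then have cC: "card C = card H" unfolding C_def by (rule card_image)
  have "B \<inter> C = {}"
  proof (rule ccontr)
    assume "B \<inter> C \<noteq> {}"
    then obtain w v where "[w\<^sup>2 = k - A * v\<^sup>2] (mod p)"
      unfolding B_def C_def cong_def by blast
    then have "[w\<^sup>2 + A * v\<^sup>2 = k] (mod p)"
      by (simp add: cong_iff_dvd_diff algebra_simps)
    with no show False by blast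
  qed
  moreover have "finite B" "finite C" by (auto simp: B_def C_def H_def)
  ultimately have "card (B \<union> C) = 2 * card H"
    using cB cC by (simp add: card_Un_disjoint)
  moreover have "B \<union> C \<subseteq> {0..<p}"
    using \<open>p > 2\<close> by (auto simp: B_def C_def)
  then have "card (B \<union> C) \<le> nat p"
    using card_mono[of "{0..<p}"] by fastforce
  moreover have "2 * int (card H) = p + 1"
    using odd \<open>p > 2\<close> by (auto simp: H_def elim!: oddE)
  ultimately show False using \<open>p > 2\<close> by linarith
qed

section \<open>Zeros of the divided difference of a cubic modulo a prime\<close>

definition slope :: "int \<Rightarrow> int \<Rightarrow> int \<Rightarrow> int \<Rightarrow> int \<Rightarrow> int" where
  "slope a b c x y = a * (x\<^sup>2 + x * y + y\<^sup>2) + b * (x + y) + c"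

lemma slope_zero_mod_prime:
  fixes p a b c :: int
  assumes p: "Factorial_Ring.prime p" "p > 3" and ab: "\<not> (p dvd a \<and> p dvd b \<and> \<not> p dvd c)"
  shows "\<exists>x y. p dvd slope a b c x y"
proof -
  have cop: "\<exists>t. [s * t = 1] (mod p)" if "\<not> p dvd s" for s
    using that p by (meson cong_solve_coprime_int coprime_commute prime_imp_coprime)
  consider "\<not> p dvd a" | "p dvd a" "\<not> p dvd b" | "p dvd a" "p dvd b" "p dvd c"
    using ab by blast
  then show ?thesis
  proof cases
    case 1
    have n2: "\<not> p dvd 2" and n3: "\<not> p dvd 3"
      using p by (auto dest: zdvd_imp_le)
    have "\<not> p dvd 3 * a\<^sup>2"
      using n3 1 p by (simp add: prime_dvd_mult_iff prime_dvd_power_iff)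
    then obtain w v where wv: "[w\<^sup>2 + 3 * a\<^sup>2 * v\<^sup>2 = 4 * b\<^sup>2 - 12 * a * c] (mod p)"
      using binary_quadratic_form_universal_mod_prime p by fastforce
    have "\<not> p dvd 3 * a" using n3 1 p by (simp add: prime_dvd_mult_iff)
    then obtain s where s: "[3 * a * s = 1] (mod p)" using cop by blast
    obtain h where h: "[2 * h = 1] (mod p)" using cop n2 by blast
    \<comment> \<open>\<open>u\<close> and \<open>v\<close> are to be x + y and x - y:
      \<open>u\<close> solves 3 a u + 2 b = w modulo \<open>p\<close>, and \<open>h\<close>, the
      inverse of 2, recovers \<open>x\<close> and \<open>y\<close>.\<close>
    define u where "u = s * (w - 2 * b)"
    define x y where "x = h * (u + v)" and "y = h * (u - v)"
    have "[3 * a * s * (w - 2 * b) = 1 * (w - 2 * b)] (mod p)"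
      by (intro cong_mult s cong_refl)
    then have u: "[3 * a * u + 2 * b = w] (mod p)"
      by (simp add: u_def cong_iff_dvd_diff algebra_simps)
    have sxy: "[x + y = u] (mod p)"
      using cong_mult[OF h cong_refl[of u]] by (simp add: x_def y_def algebra_simps)
    have dxy: "[x - y = v] (mod p)"
      using cong_mult[OF h cong_refl[of v]] by (simp add: x_def y_def algebra_simps)
    \<comment> \<open>Completing the square. The factor 12 a can be cancelled at the end, since
      \<open>p\<close> > 3 does not divide \<open>a\<close>.\<close>
    have "12 * a * slope a b c x y
        = (3 * a * (x + y) + 2 * b)\<^sup>2 + 3 * a\<^sup>2 * (x - y)\<^sup>2 - (4 * b\<^sup>2 - 12 * a * c)"
      by (simp add: slope_def power2_eq_square algebra_simps)
    also have "[\<dots> = (3 * a * u + 2 * b)\<^sup>2 + 3 * a\<^sup>2 * v\<^sup>2 - (4 * b\<^sup>2 - 12 * a * c)] (mod p)"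
      by (intro cong_diff cong_add cong_mult cong_pow cong_refl sxy dxy)
    also have "[(3 * a * u + 2 * b)\<^sup>2 + 3 * a\<^sup>2 * v\<^sup>2 - (4 * b\<^sup>2 - 12 * a * c)
        = w\<^sup>2 + 3 * a\<^sup>2 * v\<^sup>2 - (4 * b\<^sup>2 - 12 * a * c)] (mod p)"
      by (intro cong_diff cong_add cong_pow cong_refl u)
    also have "[w\<^sup>2 + 3 * a\<^sup>2 * v\<^sup>2 - (4 * b\<^sup>2 - 12 * a * c) = 0] (mod p)"
      using wv by (simp add: cong_iff_dvd_diff)
    finally have "p dvd (2 * 2 * 3 * a) * slope a b c x y"
      by (simp add: cong_0_iff)
    then have "p dvd slope a b c x y"
      using n2 n3 1 p(1) by (metis prime_dvd_mult_iff)
    then show ?thesis by blast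
  next
    case 2
    \<comment> \<open>Modulo \<open>p\<close> and at y = 0 the slope is b x + c, with root - s
      c.\<close>
    then obtain s where "[b * s = 1] (mod p)" using cop by blast
    then have "p dvd (b * s - 1) * (- c)" unfolding cong_iff_dvd_diff by (rule dvd_mult2)
    moreover have "p dvd a * (s * c)\<^sup>2" using 2 by simp
    ultimately have "p dvd a * (s * c)\<^sup>2 + (b * s - 1) * (- c)" by (rule dvd_add[rotated])
    also have "\<dots> = slope a b c (- s * c) 0"
      by (simp add: slope_def algebra_simps)
    finally show ?thesis by blast
  next
    case 3
    then have "p dvd slope a b c 0 0" by (simp add: slope_def)
    then show ?thesis by blast
  qed
qed

section \<open>Bijective cubics modulo a prime power\<close>

definition cubic :: "int \<Rightarrow> int \<Rightarrow> int \<Rightarrow> int \<Rightarrow> int \<Rightarrow> int" where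
  "cubic a b c d x = a * x ^ 3 + b * x\<^sup>2 + c * x + d"

lemma cubic_diff: "cubic a b c d x - cubic a b c d y = (x - y) * slope a b c x y"
  by (simp add: cubic_def slope_def power2_eq_square power3_eq_cube algebra_simps)

lemma cubic_cong: "[x = y] (mod m) \<Longrightarrow> [cubic a b c d x = cubic a b c d y] (mod m)"
  by (simp add: cong_iff_dvd_diff cubic_diff)

text \<open>Surjectivity passes to a divisor \<open>m\<close>: a residue modulo \<open>m\<close> is
  also one modulo \<open>n\<close>, and a preimage can be reduced modulo \<open>m\<close>. On a
  finite set a surjective self-map is injective.\<close>

lemma inj_on_cubic_divisor:
  fixes m n :: int
  assumes "m > 0" "n > 0" "m dvd n"
    and bij: "bij_betw (\<lambda>x. cubic a b c d x mod n) {0..n - 1} {0..n - 1}"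
  shows "inj_on (\<lambda>x. cubic a b c d x mod m) {0..m - 1}"
proof (rule finite_surj_inj)
  show "{0..m - 1} \<subseteq> (\<lambda>x. cubic a b c d x mod m) ` {0..m - 1}"
  proof
    fix z assume z: "z \<in> {0..m - 1}"
    with assms have "z \<in> {0..n - 1}" by (auto dest: zdvd_imp_le)
    then have "z \<in> (\<lambda>x. cubic a b c d x mod n) ` {0..n - 1}"
      using bij_betw_imp_surj_on[OF bij] by simp
    then obtain x where "cubic a b c d x mod n = z" by blast
    then have "cubic a b c d x mod m = z"
      using \<open>m dvd n\<close> z by (metis atLeastAtMost_iff mod_mod_cancel mod_pos_pos_trivial zle_diff1_eq)
    moreover have "cubic a b c d (x mod m) mod m = cubic a b c d x mod m"
      using cubic_cong[of "x mod m" x m] by (simp add: cong_def)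
    ultimately show "z \<in> (\<lambda>x. cubic a b c d x mod m) ` {0..m - 1}"
      using \<open>m > 0\<close> by (intro image_eqI[of _ _ "x mod m"]) auto
  qed
qed simp

lemma bij_betw_cubic_imp_slope_nonzero:
  fixes p :: int
  assumes p: "Factorial_Ring.prime p" and "e > 1" and "n = p ^ e"
    and bij: "bij_betw (\<lambda>x. cubic a b c d x mod n) {0..n - 1} {0..n - 1}"
  shows "\<not> p dvd slope a b c x y"
proof
  assume dvd: "p dvd slope a b c x y"
  have pos: "p > 1" "n > 0" using p \<open>n = p ^ e\<close> by (auto simp: prime_gt_1_int prime_gt_0_int)
  \<comment> \<open>Injectivity for arbitrary integers instead of reduced residues, needed for m = p
    and for m = n.\<close>
  have inj: "[s = t] (mod m)"
    if "m > 0" "m dvd n" and eq: "[cubic a b c d s = cubic a b c d t] (mod m)" for m s t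
  proof -
    have "[cubic a b c d (s mod m) = cubic a b c d (t mod m)] (mod m)"
      using eq cubic_cong[of "s mod m" s m] cubic_cong[of "t mod m" t m]
      by (metis cong_mod_left cong_refl cong_sym cong_trans)
    with inj_on_cubic_divisor[OF that(1) pos(2) that(2) bij] show ?thesis
      unfolding cong_def by (rule inj_onD) (use \<open>m > 0\<close> in auto)
  qed
  have "[cubic a b c d x = cubic a b c d y] (mod p)"
    using dvd by (simp add: cong_iff_dvd_diff cubic_diff)
  then have xy: "p dvd x - y"
    using inj[of p x y] pos \<open>n = p ^ e\<close> \<open>e > 1\<close> by (simp add: cong_iff_dvd_diff)
  \<comment> \<open>Shifting \<open>x\<close> by \<open>t\<close> changes the cubic by
    \<open>t\<close> times a slope. As e > 1, \<open>p\<close> divides \<open>t\<close>, so this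
    slope is still 0 modulo \<open>p\<close> and the change is a multiple of t p = n, although
    \<open>n\<close> does not divide \<open>t\<close>.\<close>
  define t where "t = p ^ (e - 1)"
  have nt: "n = t * p"
    using \<open>e > 1\<close> \<open>n = p ^ e\<close> by (simp add: t_def flip: power_Suc2)
  have "p dvd t" using \<open>e > 1\<close> by (simp add: t_def)
  have "slope a b c (x + t) x - slope a b c x y
      = (a * (2 * x + y) + b) * (x - y) + (a * (3 * x + t) + b) * t"
    by (simp add: slope_def power2_eq_square algebra_simps)
  also have "p dvd \<dots>"
    using xy \<open>p dvd t\<close> by simp
  finally have "p dvd (slope a b c (x + t) x - slope a b c x y) + slope a b c x y"
    using dvd by (rule dvd_add)
  then have "p dvd slope a b c (x + t) x" by simp
  then have "[cubic a b c d (x + t) = cubic a b c d x] (mod n)"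
    by (simp add: cong_iff_dvd_diff cubic_diff nt)
  then have "t * p dvd t" using inj[of n "x + t" x] pos nt by (simp add: cong_iff_dvd_diff)
  moreover have "t > 0" using pos by (simp add: t_def)
  ultimately have "t * p \<le> t" by (rule zdvd_imp_le)
  with \<open>t > 0\<close> pos show False by simp
qed

lemma bij_betw_cubic_prime_power_iff:
  fixes p :: int
  assumes p: "Factorial_Ring.prime p" "p > 3" and "e > 1" and "n = p ^ e"
  shows "bij_betw (\<lambda>x. cubic a b c d x mod n) {0..n - 1} {0..n - 1}
     \<longleftrightarrow> p dvd a \<and> p dvd b \<and> \<not> p dvd c" (is "?L \<longleftrightarrow> ?R")
proof
  assume ?L
  then have "\<not> p dvd slope a b c x y" for x y
    using bij_betw_cubic_imp_slope_nonzero assms by blast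
  then show ?R using slope_zero_mod_prime[OF p] by blast
next
  assume R: ?R
  have "n > 0" using p \<open>n = p ^ e\<close> by simp
  have "inj_on (\<lambda>x. cubic a b c d x mod n) {0..n - 1}"
  proof (rule inj_onI)
    fix x y assume xy: "x \<in> {0..n - 1}" "y \<in> {0..n - 1}"
      and "cubic a b c d x mod n = cubic a b c d y mod n"
    then have dvd: "n dvd (x - y) * slope a b c x y"
      by (simp add: mod_eq_dvd_iff cubic_diff)
    \<comment> \<open>Modulo \<open>p\<close> the slope is the constant \<open>c\<close>, so it is a
      unit modulo \<open>n\<close> and cancels.\<close>
    have "\<not> p dvd slope a b c x y"
      using R by (simp add: slope_def dvd_add_right_iff)
    then have "coprime n (slope a b c x y)"
      using p \<open>n = p ^ e\<close> by (simp add: prime_imp_coprime)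
    with dvd have "[x = y] (mod n)"
      by (simp add: coprime_dvd_mult_left_iff cong_iff_dvd_diff)
    with xy show "x = y" by (simp add: cong_def)
  qed
  moreover have "(\<lambda>x. cubic a b c d x mod n) ` {0..n - 1} \<subseteq> {0..n - 1}"
    using \<open>n > 0\<close> by auto
  ultimately show ?L
    by (simp add: bij_betw_def endo_inj_surj)
qed

section \<open>From the residue ring to integer arithmetic\<close>

lemma (in residues) res_nat_pow_eq: "x \<in> carrier R \<Longrightarrow> x [^] k = x ^ k mod m"
proof (induction k)
  case 0
  then show ?case using m_gt_one by (simp add: res_one_eq)
next
  case (Suc k)
  then show ?case by (simp add: res_mult_eq mod_mult_right_eq mod_mult_left_eq mult.commute)
qed

text \<open>Padding with zero leading coefficients lets one criterion for cubics serve all three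
  degrees.\<close>

lemma (in residues) eval_length_le_4:
  assumes "x \<in> carrier R"
  shows "eval [c, d] x = cubic 0 0 c d x mod m"
    and "eval [b, c, d] x = cubic 0 b c d x mod m"
    and "eval [a, b, c, d] x = cubic a b c d x mod m"
  using assms m_gt_one
  by (simp_all add: res_nat_pow_eq res_add_eq res_mult_eq res_zero_eq res_one_eq cubic_def mod_simps
        power2_eq_square power3_eq_cube add.assoc)

section \<open>Counting the admissible coefficients\<close>

lemma card_nonmultiples_prime_power:
  fixes p e n :: nat
  assumes "Factorial_Ring.prime p" "e > 0" "n = p ^ e"
  shows "card {x \<in> {0..int n - 1}. \<not> int p dvd x} = totient n"
proof -
  have "n > 1" using one_less_power[OF prime_gt_1_nat] assms by simp
  then interpret residues "int n" "residue_ring (int n)"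
    by unfold_locales simp_all
  have "coprime x (int n) \<longleftrightarrow> \<not> int p dvd x" for x
  proof
    assume "coprime x (int n)"
    moreover have "int p dvd int n" "\<not> is_unit (int p)"
      using assms by auto
    ultimately show "\<not> int p dvd x"
      using coprime_common_divisor by blast
  next
    assume "\<not> int p dvd x"
    with assms show "coprime x (int n)"
      by (simp add: coprime_commute[of x] prime_imp_coprime)
  qed
  \<comment> \<open>\<open>res_units_eq\<close> starts at 1; nothing is lost, because 0 is a
    multiple of \<open>p\<close>.\<close>
  then have "{x \<in> {0..int n - 1}. \<not> int p dvd x} = Units (residue_ring (int n))"
    by (fastforce simp: res_units_eq intro: le_neq_trans)
  then show ?thesis
    using totient_eq by simp
qed

theorem theorem13:
  fixes n p e :: nat
  assumes "Factorial_Ring.prime p" and "p > 3" and "e > 1" and "n = p ^ e"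
  shows "int (card (permutation_polynomials_of_degree (residue_ring (int n)) 1))
             = int n * int (totient n)
       \<and> int (card (permutation_polynomials_of_degree (residue_ring (int n)) 2))
             = (int n - int (totient n) - 1) * int n * int (totient n)
       \<and> int (card (permutation_polynomials_of_degree (residue_ring (int n)) 3))
             = (int n - int (totient n) - 1) * (int n - int (totient n)) * int n * int (totient n)"
proof -
  have "n > 1" using one_less_power[OF prime_gt_1_nat] assms by simp
  define R where "R = residue_ring (int n)"
  interpret residues "int n" R
    unfolding R_def using \<open>n > 1\<close> by unfold_locales simp_all
  define N U M where "N = {0..int n - 1}"
    and "U = {x \<in> N. \<not> int p dvd x}" and "M = {x \<in> N. int p dvd x}"
  define P where "P = permutation_polynomials_of_degree R"
  have carrier: "carrier R = N" by (simp add: N_def res_carrier_eq)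
  have bij: "bij_betw (\<lambda>x. cubic a b c d x mod int n) N N
      \<longleftrightarrow> int p dvd a \<and> int p dvd b \<and> \<not> int p dvd c" for a b c d
    unfolding N_def by (rule bij_betw_cubic_prime_power_iff[of _ e]) (use assms in auto)
  have evals: "bij_betw (eval [c, d]) N N \<longleftrightarrow> \<not> int p dvd c"
    "bij_betw (eval [b, c, d]) N N \<longleftrightarrow> int p dvd b \<and> \<not> int p dvd c"
    "bij_betw (eval [a, b, c, d]) N N \<longleftrightarrow> int p dvd a \<and> int p dvd b \<and> \<not> int p dvd c"
    for a b c d
    using bij[of 0 0 c d] bij[of 0 b c d] bij[of a b c d]
      bij_betw_cong[of N "eval [c, d]" "\<lambda>x. cubic 0 0 c d x mod int n" N]
      bij_betw_cong[of N "eval [b, c, d]" "\<lambda>x. cubic 0 b c d x mod int n" N]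
      bij_betw_cong[of N "eval [a, b, c, d]" "\<lambda>x. cubic a b c d x mod int n" N]
    by (simp_all add: eval_length_le_4 carrier del: eval.simps)
  \<comment> \<open>For k > 0 the truncated degree length - 1 excludes \<open>[]\<close>, so degree
    \<open>k\<close> means k + 1 coefficients.\<close>
  have P: "f \<in> P k \<longleftrightarrow> set f \<subseteq> N \<and> (f \<noteq> [] \<longrightarrow> hd f \<noteq> 0) \<and> bij_betw (eval f) N N \<and> length f = Suc k"
    if "k > 0" for f k
    using that
    by (auto simp: P_def permutation_polynomials_of_degree_def permutation_polynomial_def
        univ_poly_def polynomial_def carrier res_zero_eq)
  have fin: "finite N" "finite U" "finite M" by (simp_all add: N_def U_def M_def del: atLeastAtMost_iff)
  have cN: "card N = n" by (simp add: N_def)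
  have cU: "card U = totient n"
    using card_nonmultiples_prime_power[of p e n] assms by (simp add: U_def N_def)
  have "card N = card U + card M"
    using fin by (subst card_Un_disjoint[symmetric]) (auto simp: U_def M_def intro: arg_cong[of _ _ card])
  then have cM: "int (card M) = int n - int (totient n)" using cN cU by simp
  \<comment> \<open>Leading coefficients that are multiples of \<open>p\<close> must avoid 0, which
    costs one element of \<open>M\<close>.\<close>
  have "0 \<in> M" using \<open>n > 1\<close> by (simp add: M_def N_def)
  then have cM0: "int (card (M - {0})) = int n - int (totient n) - 1"
    using card_Suc_Diff1[OF fin(3) \<open>0 \<in> M\<close>] cM by linarith
  have inj1: "inj_on (\<lambda>(c, d). [c, d]) A"
    and inj2: "inj_on (\<lambda>(b, c, d). [b, c, d]) B"
    and inj3: "inj_on (\<lambda>(a, b, c, d). [a, b, c, d]) C"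
    for A :: "(int \<times> int) set" and B :: "(int \<times> int \<times> int) set"
      and C :: "(int \<times> int \<times> int \<times> int) set"
    by (auto simp: inj_on_def)
  \<comment> \<open>Here the leading coefficient lies in \<open>U\<close>, which does not contain 0
    anyway.\<close>
  have "P 1 = (\<lambda>(c, d). [c, d]) ` (U \<times> N)"
    by (auto simp: P evals U_def numeral_eq_Suc length_Suc_conv image_iff simp del: eval.simps)
  then have c1: "card (P 1) = card U * card N"
    by (simp only: card_image[OF inj1] card_cartesian_product)
  have "P 2 = (\<lambda>(b, c, d). [b, c, d]) ` ((M - {0}) \<times> U \<times> N)"
    by (auto simp: P evals U_def M_def numeral_eq_Suc length_Suc_conv image_iff simp del: eval.simps)
  then have c2: "card (P 2) = card (M - {0}) * (card U * card N)"
    by (simp only: card_image[OF inj2] card_cartesian_product)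
  \<comment> \<open>Only the cubic coefficient must be nonzero; the quadratic one ranges over all of
    \<open>M\<close>.\<close>
  have "P 3 = (\<lambda>(a, b, c, d). [a, b, c, d]) ` ((M - {0}) \<times> M \<times> U \<times> N)"
    by (auto simp: P evals U_def M_def numeral_eq_Suc length_Suc_conv image_iff simp del: eval.simps)
  then have c3: "card (P 3) = card (M - {0}) * (card M * (card U * card N))"
    by (simp only: card_image[OF inj3] card_cartesian_product)
  show ?thesis
    unfolding R_def[symmetric] P_def[symmetric] c1 c2 c3
    by (simp add: cM cM0 cU cN algebra_simps)
qed

end
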